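(* Let $\psi(z)=1+B_1z+B_2z^2+\cdots$ be a Ma-Minda function such that $\psi(\mathbb{D})$ is convex, and let $f\in\mathcal{S}^*(\psi)$. Then the logarithmic coefficients $\gamma_m$ of $f$ satisfy $$2\sum_{m=1}^{\infty}|\gamma_m|r^m\le 1\quad\text{for } 0\le r\le 1-\frac{1}{\exp(1/|B_1|)}.$$ The radius is sharp in the case when the function $f\in\mathcal{A}$ defined by $zf'(z)/f(z)=\psi(z)$ is extremal for the logarithmic coefficient bounds, i.e. when its logarithmic coefficients satisfy $|\gamma_m|=|B_1|/(2m)$ for all $m\ge1$.
   Context: $\mathbb{D}=\{|z|<1\}$. $\mathcal{A}$ is the class of analytic functions $f(z)=z+\sum_{m\ge2}a_mz^m$ on $\mathbb{D}$. A Ma-Minda function is an analytic univalent function $\psi$ on $\mathbb{D}$ with $\Re\psi>0$, $\psi(0)=1$, $\psi'(0)>0$, and $\psi(\mathbb{D})$ symmetric about the real axis. $u\prec v$ means $u=v\circ w$ for some analytic $w:\mathbb{D}\to\mathbb{D}$ with $w(0)=0$. $\mathcal{S}^*(\psi)=\{f\in\mathcal{A}: zf'(z)/f(z)\prec\psi(z)\}$. The logarithmic coefficients $\gamma_m$ of $f$ are defined by $\log(f(z)/z)=2\sum_{m=1}^{\infty}\gamma_mz^m$ (branch vanishing at $0$). *)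

theory Defs
  imports "HOL-Complex_Analysis.Complex_Analysis"
begin

abbreviation unit_disc :: "complex set" where
  "unit_disc \<equiv> ball 0 1"

definition class_A :: "(complex \<Rightarrow> complex) set" where
  "class_A = {f. f holomorphic_on unit_disc \<and>
     (\<exists>a. \<forall>z\<in>unit_disc. (\<lambda>m. a (m + 2) * z ^ (m + 2)) sums (f z - z))}"

definition ma_minda :: "(complex \<Rightarrow> complex) \<Rightarrow> bool" where
  "ma_minda \<psi> \<longleftrightarrow>
     \<psi> holomorphic_on unit_disc \<and> inj_on \<psi> unit_disc \<and>
     (\<forall>z\<in>unit_disc. Re (\<psi> z) > 0) \<and>
     \<psi> 0 = 1 \<and>
     deriv \<psi> 0 \<in> \<real> \<and> Re (deriv \<psi> 0) > 0 \<and>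
     cnj ` (\<psi> ` unit_disc) = \<psi> ` unit_disc"

definition subordinate :: "(complex \<Rightarrow> complex) \<Rightarrow> (complex \<Rightarrow> complex) \<Rightarrow> bool" where
  "subordinate u v \<longleftrightarrow>
     (\<exists>w. w holomorphic_on unit_disc \<and> w ` unit_disc \<subseteq> unit_disc \<and> w 0 = 0 \<and>
          (\<forall>z\<in>unit_disc. u z = v (w z)))"

text \<open>The function \<open>z f'(z) / f(z)\<close>, with the removable singularity at the origin filled in:
  for \<open>f\<close> in the class \<open>class_A\<close> its limit there is 1, whereas \<open>0 / 0 = 0\<close> in HOL.\<close>

definition star_quot :: "(complex \<Rightarrow> complex) \<Rightarrow> complex \<Rightarrow> complex" where
  "star_quot f z = (if z = 0 then 1 else z * deriv f z / f z)"

text \<open>That \<open>f\<close> has no zero other than the origin is implicit in \<open>z f'(z) / f(z)\<close> being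
  analytic on the disc; it is stated because division is total.\<close>

definition starlike_class :: "(complex \<Rightarrow> complex) \<Rightarrow> (complex \<Rightarrow> complex) set" where
  "starlike_class \<psi> = {f \<in> class_A.
     (\<forall>z\<in>unit_disc - {0}. f z \<noteq> 0) \<and> subordinate (star_quot f) \<psi>}"

text \<open>The branch of \<open>log (f(z) / z)\<close> on the disc vanishing at 0. It exists, and is unique on
  the disc, whenever \<open>f\<close> is in \<open>class_A\<close> and has no zero other than the origin.\<close>

definition log_branch :: "(complex \<Rightarrow> complex) \<Rightarrow> complex \<Rightarrow> complex" where
  "log_branch f = (SOME g. g holomorphic_on unit_disc \<and> g 0 = 0 \<and>
     (\<forall>z\<in>unit_disc - {0}. exp (g z) = f z / z))"

definition log_coeff :: "(complex \<Rightarrow> complex) \<Rightarrow> nat \<Rightarrow> complex" where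
  "log_coeff f m = fps_nth (fps_expansion (log_branch f) 0) m / 2"

end

theory Submission imports Defs begin

text \<open>With \<open>g = log (f(z) / z)\<close> one has \<open>z f'(z) / f(z) = 1 + z g'(z)\<close>, whose \<open>m\<close>-th coefficient is
  \<open>2 m \<gamma>\<^sub>m\<close>. Rogosinski's theorem for functions subordinate to a convex univalent function bounds
  it by \<open>|B\<^sub>1|\<close>, so the sum in question is at most \<open>- |B\<^sub>1| ln (1 - r)\<close>, which equals 1 exactly at
  the stated radius.\<close>

section \<open>Rogosinski's coefficient bound for convex images\<close>

text \<open>On each circle of radius \<open>r\<close> below 1 the values of \<open>v\<close> have
  modulus below 1, so Cauchy's inequality bounds the coefficient by \<open>1 / r ^ n\<close>.
  Letting \<open>r\<close> tend to 1 from the left removes the dependence on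
  \<open>r\<close>.\<close>

lemma norm_fps_nth_le_one:
  assumes hol: "v holomorphic_on unit_disc" and v: "v ` unit_disc \<subseteq> unit_disc"
    and V: "v has_fps_expansion V"
  shows "cmod (fps_nth V n) \<le> 1"
proof -
  have bound: "cmod (fps_nth V n) * r ^ n \<le> 1" if r: "0 < r" "r < 1" for r :: real
  proof -
    have sub: "cball 0 r \<subseteq> unit_disc" using r by auto
    have "cmod ((deriv ^^ n) v 0) \<le> fact n * 1 / r ^ n"
    proof (rule Cauchy_inequality)
      show "v holomorphic_on ball 0 r"
        using hol sub by (meson ball_subset_cball holomorphic_on_subset subset_trans)
      show "continuous_on (cball 0 r) v"
        using hol sub by (meson holomorphic_on_imp_continuous_on holomorphic_on_subset)
      show "cmod (v x) \<le> 1" if "cmod (0 - x) = r" for x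
        using v r that by (force simp: image_subset_iff)
    qed (use r in auto)
    then show ?thesis
      using r by (simp add: fps_nth_fps_expansion[OF V] norm_divide field_simps)
  qed
  have "((\<lambda>r::real. cmod (fps_nth V n) * r ^ n) \<longlongrightarrow> cmod (fps_nth V n) * 1 ^ n) (at_left 1)"
    by (intro tendsto_intros)
  moreover have "eventually (\<lambda>r::real. cmod (fps_nth V n) * r ^ n \<le> 1) (at_left 1)"
    using eventually_at_left_real[of 0 "1::real"] by (auto elim!: eventually_mono intro: bound)
  ultimately show ?thesis
    by (auto dest: tendsto_upperbound)
qed

text \<open>Exchanging the exponents turns the sum into a geometric one with ratio
  \<open>\<omega> ^ n\<close>, an \<open>m\<close>-th root of unity that equals 1 exactly when
  \<open>m\<close> divides \<open>n\<close>. This is the filter by which averaging over rotations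
  selects coefficients.\<close>

lemma sum_powers_root_of_unity:
  fixes m n :: nat
  assumes "m \<ge> 1"
  defines "\<omega> \<equiv> exp (2 * of_real pi * \<i> / of_nat m)"
  shows "(\<Sum>k<m. (\<omega> ^ k) ^ n) = (if m dvd n then of_nat m else 0)"
proof -
  have \<omega>n: "\<omega> ^ n = exp (2 * of_real pi * \<i> * of_nat n / of_nat m)"
    by (simp add: \<omega>_def flip: exp_of_nat_mult) (simp add: mult_ac)
  have "(\<Sum>k<m. (\<omega> ^ k) ^ n) = (\<Sum>k<m. (\<omega> ^ n) ^ k)"
    by (simp add: mult.commute flip: power_mult)
  also have "\<dots> = (if m dvd n then of_nat m else 0)"
  proof (cases "m dvd n")
    case True
    then have "\<omega> ^ n = 1"
      using complex_root_unity_eq_1[of m n] assms \<omega>n by simp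
    then show ?thesis using True by simp
  next
    case False
    then have "\<omega> ^ n \<noteq> 1"
      using complex_root_unity_eq_1[of m n] assms \<omega>n by simp
    moreover have "(\<omega> ^ n) ^ m = 1"
      using complex_root_unity[of m n] assms \<omega>n by simp
    ultimately show ?thesis using False by (simp add: geometric_sum)
  qed
  finally show ?thesis .
qed

text \<open>Since \<open>G\<close> is divisible by \<open>fps_X ^ m\<close>, its \<open>i\<close>-th
  power has order at least \<open>m * i\<close>, which exceeds \<open>m\<close> once
  \<open>i \<ge> 2\<close>. The power \<open>i = 0\<close> is the constant 1 and contributes nothing
  at index \<open>m \<ge> 1\<close>, so only the linear term of \<open>F\<close> survives.\<close>

lemma fps_nth_compose_low_order:
  fixes F G :: "'a::comm_ring_1 fps"
  assumes "m \<ge> 1" and G: "\<And>n. n < m \<Longrightarrow> fps_nth G n = 0"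
  shows "fps_nth (F oo G) m = fps_nth F 1 * fps_nth G m"
proof -
  have GX: "\<exists>K. G = fps_X ^ m * K"
    using G by (intro exI[of _ "fps_shift m G"]) (simp add: fps_eq_iff fps_X_power_mult_nth)
  have z: "fps_nth (G ^ i) m = 0" if "i \<ge> 2" for i
  proof -
    obtain K where K: "G = fps_X ^ m * K" using GX by blast
    have "m < m * i"
      using that \<open>m \<ge> 1\<close> by simp
    then show ?thesis
      by (simp add: K power_mult_distrib fps_X_power_mult_nth flip: power_mult)
  qed
  have "fps_nth (F oo G) m = (\<Sum>i\<in>{0..m}. fps_nth F i * fps_nth (G ^ i) m)"
    by (simp add: fps_compose_nth)
  also have "\<dots> = (\<Sum>i\<in>{1}. fps_nth F i * fps_nth (G ^ i) m)"
  proof (rule sum.mono_neutral_right)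
    show "\<forall>i\<in>{0..m} - {1}. fps_nth F i * fps_nth (G ^ i) m = 0"
    proof
      fix i assume "i \<in> {0..m} - {1}"
      then consider "i = 0" | "i \<ge> 2" by force
      then show "fps_nth F i * fps_nth (G ^ i) m = 0"
        by cases (use z \<open>m \<ge> 1\<close> in auto)
    qed
  qed (use \<open>m \<ge> 1\<close> in auto)
  finally show ?thesis by simp
qed

text \<open>Averaging \<open>h\<close> over the rotations by the \<open>m\<close>-th roots of unity stays in the convex image
  and kills all coefficients below the \<open>m\<close>-th except the constant one. Composing with
  \<open>\<psi>\<inverse>\<close> divides the \<open>m\<close>-th coefficient by \<open>\<psi>'(0)\<close> and yields a self-map of the disc.\<close>

lemma rogosinski_convex:
  assumes hol\<psi>: "\<psi> holomorphic_on unit_disc" and inj: "inj_on \<psi> unit_disc"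
    and conv: "convex (\<psi> ` unit_disc)"
    and holh: "h holomorphic_on unit_disc" and sub: "h ` unit_disc \<subseteq> \<psi> ` unit_disc"
    and h0: "h 0 = \<psi> 0" and H: "h has_fps_expansion H" and m: "m \<ge> 1"
  shows "cmod (fps_nth H m) \<le> cmod (deriv \<psi> 0)"
proof -
  define \<omega> where "\<omega> = exp (2 * of_real pi * \<i> / of_nat m)"
  have norm\<omega>: "cmod (\<omega> ^ k) = 1" for k
    by (simp add: \<omega>_def norm_power)
  have rot: "\<omega> ^ k * z \<in> unit_disc" if "z \<in> unit_disc" for k z
    using that norm\<omega>[of k] by (simp add: norm_mult)
  define G where "G z = (\<Sum>k<m. (1 / real m) *\<^sub>R h (\<omega> ^ k * z))" for z
  have G_in: "G z \<in> \<psi> ` unit_disc" if "z \<in> unit_disc" for z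
    unfolding G_def
    by (rule convex_sum) (use conv m sub rot that in auto)
  have G0: "G 0 = \<psi> 0"
    using m by (simp add: G_def h0 scaleR_conv_of_real)
  have holG: "G holomorphic_on unit_disc"
  proof -
    have "(h \<circ> (\<lambda>z. \<omega> ^ k * z)) holomorphic_on unit_disc" for k
      by (rule holomorphic_on_compose_gen[OF _ holh])
         (use rot in \<open>auto intro!: holomorphic_intros\<close>)
    then show ?thesis
      unfolding G_def scaleR_conv_of_real by (intro holomorphic_intros) (simp add: o_def)
  qed
  \<comment> \<open>Subtracting the value at the origin makes the constant coefficient of
    \<open>K\<close> vanish. Hence \<open>K\<close> may be substituted into the expansion of the
    inverse of \<open>\<psi>\<close> about \<open>\<psi> 0\<close>, and all its coefficients below
    index \<open>m\<close> are 0.\<close>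
  define K where "K = (\<Sum>k<m. fps_const (of_real (1 / real m)) * (H oo (fps_const (\<omega> ^ k) * fps_X))) - fps_const (\<psi> 0)"
  have G_exp: "(\<lambda>z. G z - \<psi> 0) has_fps_expansion K"
  proof -
    have "(h \<circ> (\<lambda>z. \<omega> ^ k * z)) has_fps_expansion (H oo (fps_const (\<omega> ^ k) * fps_X))" for k
      by (intro has_fps_expansion_compose H fps_expansion_intros) simp
    then show ?thesis
      unfolding G_def K_def by (intro fps_expansion_intros) (simp add: o_def)
  qed
  have H0: "fps_nth H 0 = \<psi> 0"
    using has_fps_expansion_imp_0_eq_fps_nth_0[OF H] h0 by simp
  have K_nth: "fps_nth K n = (if m dvd n then fps_nth H n else 0) - (if n = 0 then \<psi> 0 else 0)" for n
  proof -
    have "fps_nth K n = (\<Sum>k<m. (\<omega> ^ k) ^ n) * fps_nth H n / of_nat m - (if n = 0 then \<psi> 0 else 0)"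
      by (simp add: K_def fps_sum_nth fps_compose_linear sum_distrib_right sum_divide_distrib)
    also have "\<dots> = (if m dvd n then fps_nth H n else 0) - (if n = 0 then \<psi> 0 else 0)"
      using sum_powers_root_of_unity[OF m, of n] m by (simp add: \<omega>_def)
    finally show ?thesis .
  qed
  obtain \<phi> where hol\<phi>: "\<phi> holomorphic_on (\<psi> ` unit_disc)"
    and d: "\<And>z. z \<in> unit_disc \<Longrightarrow> deriv \<psi> z * deriv \<phi> (\<psi> z) = 1"
    and inv: "\<And>z. z \<in> unit_disc \<Longrightarrow> \<phi> (\<psi> z) = z"
    using holomorphic_has_inverse[OF hol\<psi> _ inj] by auto
  have "open (\<psi> ` unit_disc)"
    by (rule open_mapping_thm3[OF hol\<psi> _ inj]) auto
  then have "\<phi> analytic_on {\<psi> 0}"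
    using hol\<phi> analytic_at by auto
  then have \<phi>_exp: "(\<lambda>y. \<phi> (\<psi> 0 + y)) has_fps_expansion fps_expansion \<phi> (\<psi> 0)"
    by (rule analytic_at_imp_has_fps_expansion)
  have v_exp: "(\<phi> \<circ> G) has_fps_expansion (fps_expansion \<phi> (\<psi> 0) oo K)"
  proof -
    have "((\<lambda>y. \<phi> (\<psi> 0 + y)) \<circ> (\<lambda>z. G z - \<psi> 0)) has_fps_expansion (fps_expansion \<phi> (\<psi> 0) oo K)"
      by (rule has_fps_expansion_compose[OF \<phi>_exp G_exp]) (use K_nth[of 0] H0 in simp)
    then show ?thesis by (simp add: o_def)
  qed
  have "cmod (fps_nth (fps_expansion \<phi> (\<psi> 0) oo K) m) \<le> 1"
  proof (rule norm_fps_nth_le_one[OF _ _ v_exp])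
    show "(\<phi> \<circ> G) holomorphic_on unit_disc"
      by (rule holomorphic_on_compose_gen[OF holG hol\<phi>]) (use G_in in auto)
    show "(\<phi> \<circ> G) ` unit_disc \<subseteq> unit_disc"
    proof clarify
      fix z :: complex assume "z \<in> unit_disc"
      then obtain u where "u \<in> unit_disc" "G z = \<psi> u" using G_in by blast
      then show "(\<phi> \<circ> G) z \<in> unit_disc" using inv by simp
    qed
  qed
  also have "fps_nth (fps_expansion \<phi> (\<psi> 0) oo K) m = deriv \<phi> (\<psi> 0) * fps_nth H m"
  proof -
    have low: "fps_nth K n = 0" if "n < m" for n
      using that H0 by (cases "n = 0") (auto simp: K_nth)
    have "fps_nth K m = fps_nth H m" using m by (simp add: K_nth)
    moreover have "fps_nth (fps_expansion \<phi> (\<psi> 0)) 1 = deriv \<phi> (\<psi> 0)"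
      by (simp add: fps_expansion_def)
    ultimately show ?thesis
      using fps_nth_compose_low_order[OF m low] by simp
  qed
  \<comment> \<open>Multiplying by the modulus of \<open>deriv \<psi> 0\<close> cancels the
    derivative of the inverse function, as the two derivatives have product 1.\<close>
  finally have "cmod (deriv \<psi> 0) * cmod (deriv \<phi> (\<psi> 0) * fps_nth H m) \<le> cmod (deriv \<psi> 0)"
    by (simp add: mult_left_le)
  moreover have "cmod (deriv \<psi> 0) * cmod (deriv \<phi> (\<psi> 0) * fps_nth H m) =
      cmod (deriv \<psi> 0 * deriv \<phi> (\<psi> 0)) * cmod (fps_nth H m)"
    by (simp add: norm_mult)
  ultimately show ?thesis using d[of 0] by simp
qed

section \<open>Logarithmic coefficients of functions in the starlike class\<close>

lemma class_A_normalized: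
  assumes "f \<in> class_A"
  shows "f holomorphic_on unit_disc" "f 0 = 0" "deriv f 0 = 1"
proof -
  show "f holomorphic_on unit_disc" using assms by (simp add: class_A_def)
  obtain a where a: "\<And>z. z \<in> unit_disc \<Longrightarrow> (\<lambda>m. a (m + 2) * z ^ (m + 2)) sums (f z - z)"
    using assms unfolding class_A_def by blast
  \<comment> \<open>The series in \<open>class_A\<close> starts at exponent 2 and leaves
    \<open>a 0\<close> and \<open>a 1\<close> arbitrary; they are replaced by the true coefficients
    0 and 1.\<close>
  define F where "F = Abs_fps (\<lambda>n. if n = 0 then 0 else if n = 1 then 1 else a n)"
  have "f has_fps_expansion F"
  proof (rule has_fps_expansionI)
    have "(\<lambda>n. fps_nth F n * z ^ n) sums f z" if "z \<in> unit_disc" for z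
    proof -
      have "(\<lambda>n. fps_nth F (n + 2) * z ^ (n + 2)) sums (f z - (\<Sum>n<2. fps_nth F n * z ^ n))"
        using a[OF that] by (simp add: F_def numeral_2_eq_2)
      then show ?thesis by (subst (asm) sums_iff_shift) simp
    qed
    then show "\<forall>\<^sub>F z in nhds 0. (\<lambda>n. fps_nth F n * z ^ n) sums f z"
      by (intro eventually_nhds[THEN iffD2] exI[of _ unit_disc]) auto
  qed
  then show "f 0 = 0" "deriv f 0 = 1"
    using fps_nth_fps_expansion[of f F 0] fps_nth_fps_expansion[of f F 1] by (auto simp: F_def)
qed

text \<open>The choice in \<open>log_branch\<close> has a witness: \<open>f z / z\<close>, with
  value 1 filled in at the origin, is holomorphic and free of zeros on the contractible disc, so it
  has a holomorphic logarithm there.\<close>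

lemma log_branch_properties:
  assumes f: "f \<in> class_A" and nz: "\<forall>z\<in>unit_disc - {0}. f z \<noteq> 0"
  shows "log_branch f holomorphic_on unit_disc" "log_branch f 0 = 0"
    "\<And>z. z \<in> unit_disc - {0} \<Longrightarrow> exp (log_branch f z) = f z / z"
proof -
  note A = class_A_normalized[OF f]
  define F where "F z = (if z = 0 then 1 else f z / z)" for z
  have "F holomorphic_on unit_disc"
    using pole_lemma_open[OF A(1), of 0] A unfolding F_def
    by (simp cong: if_cong)
  moreover have "F z \<noteq> 0" if "z \<in> unit_disc" for z
    using that nz by (auto simp: F_def)
  ultimately obtain g where g: "g holomorphic_on unit_disc" "\<And>z. z \<in> unit_disc \<Longrightarrow> F z = exp (g z)"
    using contractible_imp_holomorphic_log[of F unit_disc] convex_imp_contractible by blast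
  have "exp (g 0) = 1" using g(2)[of 0] by (simp add: F_def)
  moreover have "exp (g z) = f z / z" if "z \<in> unit_disc - {0}" for z
    using g(2)[of z] that by (simp add: F_def)
  \<comment> \<open>As \<open>exp (g 0) = 1\<close>, subtracting \<open>g 0\<close> normalizes the
    branch at the origin without changing its exponential.\<close>
  ultimately have "\<exists>g. g holomorphic_on unit_disc \<and> g 0 = 0 \<and> (\<forall>z\<in>unit_disc - {0}. exp (g z) = f z / z)"
    using g(1) by (intro exI[of _ "\<lambda>z. g z - g 0"]) (auto simp: exp_diff intro!: holomorphic_on_diff)
  from someI_ex[OF this]
  show "log_branch f holomorphic_on unit_disc" "log_branch f 0 = 0"
    "\<And>z. z \<in> unit_disc - {0} \<Longrightarrow> exp (log_branch f z) = f z / z"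
    unfolding log_branch_def by blast+
qed

text \<open>Away from the origin this is the logarithmic derivative of
  \<open>f z = z * exp (log_branch f z)\<close>; at the origin both sides are 1 by the value that
  \<open>star_quot\<close> prescribes there.\<close>

lemma star_quot_eq_deriv_log_branch:
  assumes f: "f \<in> class_A" and nz: "\<forall>z\<in>unit_disc - {0}. f z \<noteq> 0" and z: "z \<in> unit_disc"
  shows "star_quot f z = 1 + z * deriv (log_branch f) z"
proof (cases "z = 0")
  case False
  note L = log_branch_properties[OF f nz]
  have "((\<lambda>z. z * exp (log_branch f z)) has_field_derivative
      exp (log_branch f z) + z * (deriv (log_branch f) z * exp (log_branch f z))) (at z)"
    using holomorphic_derivI[OF L(1) _ z] by (auto intro!: derivative_eq_intros)
  moreover have "eventually (\<lambda>z. z * exp (log_branch f z) = f z) (nhds z)"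
    using eventually_nhds_in_open[of "unit_disc - {0}" z] z False L(3)
    by (force simp: open_Diff elim!: eventually_mono)
  ultimately have "(f has_field_derivative
      exp (log_branch f z) + z * (deriv (log_branch f) z * exp (log_branch f z))) (at z)"
    by (subst (asm) DERIV_cong_ev) auto
  then have "deriv f z = exp (log_branch f z) * (1 + z * deriv (log_branch f) z)"
    by (simp add: DERIV_imp_deriv algebra_simps)
  then show ?thesis
    using L(3)[of z] z False nz by (simp add: star_quot_def)
qed (simp add: star_quot_def)

lemma norm_log_coeff_le:
  assumes \<psi>: "\<psi> holomorphic_on unit_disc" "inj_on \<psi> unit_disc" "convex (\<psi> ` unit_disc)" "\<psi> 0 = 1"
    and f: "f \<in> starlike_class \<psi>" and m: "m \<ge> 1"
  shows "cmod (log_coeff f m) \<le> cmod (deriv \<psi> 0) / (2 * real m)"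
proof -
  have fA: "f \<in> class_A" and nz: "\<forall>z\<in>unit_disc - {0}. f z \<noteq> 0"
    and "subordinate (star_quot f) \<psi>"
    using f by (auto simp: starlike_class_def)
  then obtain w where w: "w ` unit_disc \<subseteq> unit_disc" "\<And>z. z \<in> unit_disc \<Longrightarrow> star_quot f z = \<psi> (w z)"
    by (auto simp: subordinate_def)
  note L = log_branch_properties[OF fA nz]
  \<comment> \<open>This agrees with \<open>star_quot f\<close> on the disc, but its holomorphy and
    its expansion can be read off from \<open>log_branch f\<close>.\<close>
  define h where "h z = 1 + z * deriv (log_branch f) z" for z
  define L' where "L' = fps_expansion (log_branch f) 0"
  have "log_branch f has_fps_expansion L'"
    unfolding L'_def by (rule has_fps_expansion_fps_expansion[OF _ _ L(1)]) auto
  then have H: "h has_fps_expansion 1 + fps_X * fps_deriv L'"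
    unfolding h_def by (intro fps_expansion_intros)
  have "cmod (fps_nth (1 + fps_X * fps_deriv L') m) \<le> cmod (deriv \<psi> 0)"
  proof (rule rogosinski_convex[OF \<psi>(1-3) _ _ _ H m])
    show "h holomorphic_on unit_disc"
      unfolding h_def by (intro holomorphic_intros L) auto
    show "h ` unit_disc \<subseteq> \<psi> ` unit_disc"
      using w star_quot_eq_deriv_log_branch[OF fA nz] by (force simp: h_def)
    show "h 0 = \<psi> 0" by (simp add: h_def \<psi>)
  qed
  moreover have "fps_nth (1 + fps_X * fps_deriv L') m = of_nat m * (2 * log_coeff f m)"
    using m by (simp add: log_coeff_def L'_def of_nat_diff)
  ultimately show ?thesis
    using m by (simp add: norm_mult field_simps)
qed

section \<open>Summation of the bounds and the radius\<close>

lemma minus_ln_series: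
  fixes r :: real
  assumes "0 \<le> r" "r < 1"
  shows "(\<lambda>m. r ^ (m + 1) / real (m + 1)) sums (- ln (1 - r))"
proof -
  have "(\<lambda>n. - (r ^ n / real n)) sums ln (1 - r)"
    using ln_series'[of "-r"] assms by simp
  then have "(\<lambda>n. r ^ n / real n) sums (- ln (1 - r))"
    using sums_minus by fastforce
  \<comment> \<open>The term with \<open>n = 0\<close> is \<open>1 / 0 = 0\<close> in HOL, so the
    shift of index leaves the sum unchanged.\<close>
  then show ?thesis
    using sums_Suc_iff[of "\<lambda>n. r ^ n / real n" "- ln (1 - r)"] by simp
qed

theorem theorem3p1:
  fixes \<psi> :: "complex \<Rightarrow> complex" and B :: "nat \<Rightarrow> complex" and R :: real
  assumes "ma_minda \<psi>"
    and "\<forall>z\<in>unit_disc. (\<lambda>m. B (m + 1) * z ^ (m + 1)) sums (\<psi> z - 1)"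
    and "convex (\<psi> ` unit_disc)"
    and "R = 1 - 1 / exp (1 / cmod (B 1))"
  shows "(\<forall>f\<in>starlike_class \<psi>. \<forall>r::real. 0 \<le> r \<and> r \<le> R \<longrightarrow>
            summable (\<lambda>m. cmod (log_coeff f (m + 1)) * r ^ (m + 1)) \<and>
            2 * (\<Sum>m. cmod (log_coeff f (m + 1)) * r ^ (m + 1)) \<le> 1)
       \<and> (\<forall>f\<in>class_A.
            (\<forall>z\<in>unit_disc - {0}. f z \<noteq> 0) \<and>
            (\<forall>z\<in>unit_disc. star_quot f z = \<psi> z) \<and>
            (\<forall>m\<ge>1. cmod (log_coeff f m) = cmod (B 1) / (2 * real m)) \<longrightarrow>
            f \<in> starlike_class \<psi> \<and>
            (\<forall>r::real. R < r \<and> r < 1 \<longrightarrow>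
               summable (\<lambda>m. cmod (log_coeff f (m + 1)) * r ^ (m + 1)) \<and>
               2 * (\<Sum>m. cmod (log_coeff f (m + 1)) * r ^ (m + 1)) > 1))"
proof -
  have hol: "\<psi> holomorphic_on unit_disc" and inj: "inj_on \<psi> unit_disc" and \<psi>0: "\<psi> 0 = 1"
    and dpos: "Re (deriv \<psi> 0) > 0"
    using assms(1) by (auto simp: ma_minda_def)
  \<comment> \<open>The given series starts at exponent 1, so \<open>B 0\<close> is arbitrary. With
    constant term 1 in its place, uniqueness of the expansion identifies \<open>B 1\<close>.\<close>
  have B1: "B 1 = deriv \<psi> 0"
  proof -
    define F where "F = Abs_fps (\<lambda>n. if n = 0 then 1 else B n)"
    have "\<psi> has_fps_expansion F"
    proof (rule has_fps_expansionI)
      have "(\<lambda>n. fps_nth F n * z ^ n) sums \<psi> z" if "z \<in> unit_disc" for z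
      proof -
        have "(\<lambda>n. fps_nth F (Suc n) * z ^ Suc n) sums (\<psi> z - 1)"
          using assms(2) that by (simp add: F_def)
        from sums_Suc[OF this] show ?thesis by (simp add: F_def)
      qed
      then show "\<forall>\<^sub>F z in nhds 0. (\<lambda>n. fps_nth F n * z ^ n) sums \<psi> z"
        by (intro eventually_nhds[THEN iffD2] exI[of _ unit_disc]) auto
    qed
    from fps_nth_fps_expansion[OF this, of 1] show ?thesis by (simp add: F_def)
  qed
  define b where "b = cmod (B 1)"
  have b: "b > 0" using dpos unfolding b_def B1 by (metis zero_complex.sel(1) less_irrefl zero_less_norm_iff)
  have R: "R = 1 - exp (- (1 / b))"
    by (simp add: assms(4) b_def exp_minus inverse_eq_divide)
  have R01: "0 \<le> R" "R < 1" using b by (auto simp: R)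
  \<comment> \<open>This series serves both halves: it dominates the one for any \<open>f\<close> in
    the class and coincides with it in the extremal case.\<close>
  have maj: "(\<lambda>m. b / (2 * real (m + 1)) * r ^ (m + 1)) sums (b / 2 * - ln (1 - r))"
    if "0 \<le> r" "r < 1" for r
    using sums_mult[OF minus_ln_series[OF that], of "b / 2"] by simp
  \<comment> \<open>The radius is the solution of this equation: twice the sum of the majorant is
    \<open>b * - ln (1 - r)\<close>, strictly increasing in \<open>r\<close>, and it reaches 1 at
    \<open>R\<close>.\<close>
  have ln_R: "b * - ln (1 - R) = 1" using b by (simp add: R)
  have upper: "summable (\<lambda>m. cmod (log_coeff f (m + 1)) * r ^ (m + 1)) \<and>
      2 * (\<Sum>m. cmod (log_coeff f (m + 1)) * r ^ (m + 1)) \<le> 1"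
    if f: "f \<in> starlike_class \<psi>" and r: "0 \<le> r" "r \<le> R" for f r
  proof -
    have r1: "r < 1" using r R01 by simp
    have le: "cmod (log_coeff f (m + 1)) * r ^ (m + 1) \<le> b / (2 * real (m + 1)) * r ^ (m + 1)" for m
      using norm_log_coeff_le[OF hol inj assms(3) \<psi>0 f, of "m + 1"] r
      unfolding b_def B1 by (intro mult_right_mono) auto
    have summ: "summable (\<lambda>m. cmod (log_coeff f (m + 1)) * r ^ (m + 1))"
      by (rule summable_comparison_test'[OF sums_summable[OF maj[OF r(1) r1]], of 0])
         (use le r in \<open>simp add: abs_mult\<close>)
    have "(\<Sum>m. cmod (log_coeff f (m + 1)) * r ^ (m + 1)) \<le> b / 2 * - ln (1 - r)"
      using suminf_le[OF le summ sums_summable[OF maj[OF r(1) r1]]] sums_unique[OF maj[OF r(1) r1]]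
      by simp
    moreover have "b * - ln (1 - r) \<le> b * - ln (1 - R)"
      using b r R01 by (intro mult_left_mono) auto
    ultimately show ?thesis using summ ln_R by simp
  qed
  have sharp: "f \<in> starlike_class \<psi> \<and> (\<forall>r::real. R < r \<and> r < 1 \<longrightarrow>
      summable (\<lambda>m. cmod (log_coeff f (m + 1)) * r ^ (m + 1)) \<and>
      2 * (\<Sum>m. cmod (log_coeff f (m + 1)) * r ^ (m + 1)) > 1)"
    if f: "f \<in> class_A" and nz: "\<forall>z\<in>unit_disc - {0}. f z \<noteq> 0"
      and q: "\<forall>z\<in>unit_disc. star_quot f z = \<psi> z"
      and ext: "\<forall>m\<ge>1. cmod (log_coeff f m) = cmod (B 1) / (2 * real m)" for f
  proof (intro conjI allI impI)
    have "subordinate (star_quot f) \<psi>"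
      unfolding subordinate_def using q by (intro exI[of _ "\<lambda>z. z"]) (auto intro: holomorphic_intros)
    then show "f \<in> starlike_class \<psi>" using f nz by (simp add: starlike_class_def)
  next
    fix r :: real assume r: "R < r \<and> r < 1"
    \<comment> \<open>Extremality makes every term equal to that of the majorant, so the sum is
      known exactly and strict monotonicity beyond \<open>R\<close> pushes its double above
      1.\<close>
    then have "(\<lambda>m. cmod (log_coeff f (m + 1)) * r ^ (m + 1)) sums (b / 2 * - ln (1 - r))"
      using maj[of r] R01 ext by (simp add: b_def)
    moreover have "b * - ln (1 - R) < b * - ln (1 - r)"
      using b r R01 by (intro mult_strict_left_mono) auto
    ultimately show "summable (\<lambda>m. cmod (log_coeff f (m + 1)) * r ^ (m + 1))"
      and "2 * (\<Sum>m. cmod (log_coeff f (m + 1)) * r ^ (m + 1)) > 1"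
      using ln_R by (auto simp: sums_iff)
  qed
  show ?thesis
    by (rule conjI; (rule ballI, (intro allI)?, rule impI); elim conjE) (rule upper sharp; assumption)+
qed

end
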